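(* Let $U, V, W$ be vector spaces over a field $F$ and let $T_1 \colon V \to W$ and $T_2 \colon U \to V$ be linear. Then $G_2G_1$ is an inner inverse of $T_1T_2$ for all inner inverses $G_1$ of $T_1$ and $G_2$ of $T_2$ if and only if $T_1T_2 = 0$ or $\operatorname{Ker} T_1 \leq \operatorname{Im} T_2$.
   Context: Vector spaces are arbitrary (possibly infinite-dimensional). For a linear map $T\colon V\to W$, a linear map $G\colon W\to V$ is called an inner inverse of $T$ if $TGT=T$. For subspaces, $\leq$ denotes inclusion. *)

theory Defs
  imports Complex_Main
begin

text \<open>The scalar multiplications of the domain and the codomain of \<open>T\<close> are explicit parameters,
  since the scalars range over an arbitrary field. As in the definition being formalized,
  an inner inverse is itself required to be linear.\<close>

definition inner_inverse ::
  "('f::field \<Rightarrow> 'v::ab_group_add \<Rightarrow> 'v) \<Rightarrow> ('f \<Rightarrow> 'w::ab_group_add \<Rightarrow> 'w) \<Rightarrow>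
    ('v \<Rightarrow> 'w) \<Rightarrow> ('w \<Rightarrow> 'v) \<Rightarrow> bool"
  where "inner_inverse sV sW T G \<longleftrightarrow> Vector_Spaces.linear sW sV G \<and> T \<circ> G \<circ> T = T"

end

theory Submission
  imports Defs
begin

text \<open>If \<open>Ker T\<^sub>1 \<subseteq> Im T\<^sub>2\<close>, then \<open>G\<^sub>1 (T\<^sub>1 (T\<^sub>2 u))\<close> differs from \<open>T\<^sub>2 u\<close> by an element of
  \<open>Ker T\<^sub>1\<close>, so it lies in \<open>Im T\<^sub>2\<close>, where \<open>T\<^sub>2 G\<^sub>2\<close> is the identity. Conversely, suppose
  \<open>w = T\<^sub>1 (T\<^sub>2 u) \<noteq> 0\<close> and \<open>k \<in> Ker T\<^sub>1 - Im T\<^sub>2\<close>. An inner inverse of \<open>T\<^sub>1\<close> may send \<open>w\<close> to any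
  preimage, in particular to \<open>T\<^sub>2 u + k \<notin> Im T\<^sub>2\<close>, and an inner inverse of \<open>T\<^sub>2\<close> may
  vanish there, so the composition sends \<open>w\<close> to \<open>0\<close>.\<close>

lemma inner_inverse_apply:
  assumes "inner_inverse sV sW T G"
  shows "T (G (T v)) = T v"
  using assms by (metis comp_apply inner_inverse_def)

text \<open>A linear map can be prescribed freely on an independent set, and
  \<open>T \<circ> G\<close> has to be the identity only on \<open>range T\<close>. So the value at
  \<open>w\<close> is constrained only if \<open>w\<close> lies in \<open>range T\<close>, where it
  must be a preimage.\<close>

lemma inner_inverse_with_value:
  fixes sV :: "'f::field \<Rightarrow> 'v::ab_group_add \<Rightarrow> 'v"
    and sW :: "'f \<Rightarrow> 'w::ab_group_add \<Rightarrow> 'w"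
  assumes T: "Vector_Spaces.linear sV sW T"
    and "w \<noteq> 0" and w: "w \<in> range T \<Longrightarrow> T x = w"
  obtains G where "inner_inverse sV sW T G" "G w = x"
proof -
  interpret T: Vector_Spaces.linear sV sW T by (fact T)
  interpret WV: vector_space_pair sW sV ..
  interpret WW: vector_space_pair sW sW ..
  have sub: "T.vs2.subspace (range T)"
    using T.subspace_image T.vs1.subspace_UNIV by blast
  \<comment> \<open>In both cases \<open>C\<close> consists of \<open>w\<close> and a basis of
    \<open>range T\<close>; it need not span the codomain.\<close>
  obtain C where C: "T.vs2.independent C" "w \<in> C" "range T \<subseteq> T.vs2.span (C \<inter> range T)"
  proof (cases "w \<in> range T")
    case True
    have "T.vs2.independent {w}"
      using \<open>w \<noteq> 0\<close> by simp
    with True obtain C where "{w} \<subseteq> C" "C \<subseteq> range T" "T.vs2.independent C"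
      "range T \<subseteq> T.vs2.span C"
      using T.vs2.maximal_independent_subset_extend[of "{w}" "range T"] by auto
    then show ?thesis
      using that[of C] by (simp add: Int_absorb2)
  next
    case False
    obtain B where B: "B \<subseteq> range T" "T.vs2.independent B" "range T \<subseteq> T.vs2.span B"
      using T.vs2.maximal_independent_subset[of "range T"] by auto
    have "w \<notin> T.vs2.span B"
      using False B(1) T.vs2.span_minimal[OF _ sub] by blast
    then have "T.vs2.independent (insert w B)"
      using B(2) by (simp add: T.vs2.independent_insert)
    moreover have "insert w B \<inter> range T = B"
      using False B(1) by auto
    ultimately show ?thesis
      using that[of "insert w B"] B(3) by simp
  qed
  \<comment> \<open>\<open>inv T c\<close> is a preimage only for \<open>c\<close> in
    \<open>range T\<close>; the one element of \<open>C\<close> that can lie outside is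
    \<open>w\<close>, which gets \<open>x\<close>.\<close>
  define f where "f c = (if c = w then x else inv T c)" for c
  obtain G where G: "Vector_Spaces.linear sW sV G" "\<And>c. c \<in> C \<Longrightarrow> G c = f c"
    using WV.linear_independent_extend[OF C(1), of f] by blast
  have "T (G y) = y" if "y \<in> range T" for y
  proof -
    have "Vector_Spaces.linear sW sW (T \<circ> G)"
      using G(1) T by (rule Vector_Spaces.linear_compose)
    moreover have "(T \<circ> G) c = id c" if "c \<in> C \<inter> range T" for c
      using that w G(2) by (auto simp: f_def f_inv_into_f)
    ultimately have "(T \<circ> G) y = id y"
      using WW.linear_eq_on[OF _ T.vs2.linear_id] \<open>y \<in> range T\<close> C(3) by blast
    then show ?thesis by simp
  qed
  then have "inner_inverse sV sW T G"
    using G(1) by (auto simp: inner_inverse_def)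
  moreover have "G w = x"
    using G(2) C(2) by (simp add: f_def)
  ultimately show ?thesis
    using that by blast
qed

theorem theorem12:
  fixes sU :: "'f::field \<Rightarrow> 'u::ab_group_add \<Rightarrow> 'u"
    and sV :: "'f \<Rightarrow> 'v::ab_group_add \<Rightarrow> 'v"
    and sW :: "'f \<Rightarrow> 'w::ab_group_add \<Rightarrow> 'w"
    and T1 :: "'v \<Rightarrow> 'w"
    and T2 :: "'u \<Rightarrow> 'v"
  assumes "vector_space sU" and "vector_space sV" and "vector_space sW"
    and "Vector_Spaces.linear sV sW T1"
    and "Vector_Spaces.linear sU sV T2"
  shows "(\<forall>G1 G2. inner_inverse sV sW T1 G1 \<and> inner_inverse sU sV T2 G2 \<longrightarrow>
            inner_inverse sU sW (T1 \<circ> T2) (G2 \<circ> G1))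
         \<longleftrightarrow> T1 \<circ> T2 = (\<lambda>_. 0) \<or> {v. T1 v = 0} \<subseteq> range T2"
    (is "?L \<longleftrightarrow> ?R")
proof
  interpret T1: Vector_Spaces.linear sV sW T1 by fact
  interpret T2: Vector_Spaces.linear sU sV T2 by fact
  show ?R if ?L
  proof (rule ccontr)
    assume "\<not> ?R"
    then obtain u k where u: "T1 (T2 u) \<noteq> 0" and k: "T1 k = 0" "k \<notin> range T2"
      by (auto simp: fun_eq_iff)
    define v where "v = T2 u + k"
    have T1v: "T1 v = T1 (T2 u)"
      by (simp add: v_def T1.add k)
    have "v \<notin> range T2"
    proof
      assume "v \<in> range T2"
      then obtain u' where "T2 u' = T2 u + k"
        by (auto simp: v_def)
      then have "k = T2 (u' - u)"
        by (simp add: T2.diff)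
      with k(2) show False by blast
    qed
    moreover have "v \<noteq> 0"
      using u T1v T1.zero by metis
    \<comment> \<open>Outside \<open>range T2\<close> the prescribed value is unconstrained, so 0 is
      allowed.\<close>
    ultimately obtain G2 where G2: "inner_inverse sU sV T2 G2" "G2 v = 0"
      using inner_inverse_with_value[OF assms(5), of v 0] by blast
    obtain G1 where G1: "inner_inverse sV sW T1 G1" "G1 (T1 (T2 u)) = v"
      using inner_inverse_with_value[OF assms(4) u, of v] T1v by blast
    have "inner_inverse sU sW (T1 \<circ> T2) (G2 \<circ> G1)"
      using \<open>?L\<close> G1(1) G2(1) by blast
    from inner_inverse_apply[OF this, of u] show False
      using u by (simp add: G1(2) G2(2) T1.zero T2.zero)
  qed
  show ?L if ?R
  proof (intro allI impI, elim conjE)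
    fix G1 G2
    assume G1: "inner_inverse sV sW T1 G1" and G2: "inner_inverse sU sV T2 G2"
    have "T1 (T2 (G2 (G1 (T1 (T2 u))))) = T1 (T2 u)" for u
    proof (cases "T1 \<circ> T2 = (\<lambda>_. 0)")
      case True
      then show ?thesis by (simp add: fun_eq_iff)
    next
      case False
      have "T1 (G1 (T1 (T2 u)) - T2 u) = 0"
        by (simp add: T1.diff inner_inverse_apply[OF G1])
      with False \<open>?R\<close> obtain u' where "G1 (T1 (T2 u)) - T2 u = T2 u'"
        by blast
      then have "G1 (T1 (T2 u)) = T2 (u' + u)"
        by (simp add: T2.add algebra_simps)
      \<comment> \<open>\<open>T2 \<circ> G2\<close> fixes \<open>G1 (T1 (T2 u))\<close>, and
        \<open>T1\<close> sends this vector to \<open>T1 (T2 u)\<close>.\<close>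
      then show ?thesis
        by (metis inner_inverse_apply[OF G1] inner_inverse_apply[OF G2])
    qed
    moreover have "Vector_Spaces.linear sW sU (G2 \<circ> G1)"
      using G1 G2 by (auto simp: inner_inverse_def intro: Vector_Spaces.linear_compose)
    ultimately show "inner_inverse sU sW (T1 \<circ> T2) (G2 \<circ> G1)"
      by (simp add: inner_inverse_def fun_eq_iff)
  qed
qed

end
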